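(* Let $\mu$ be a compactly supported Borel probability measure on a metric space and let $\Phi,\Phi_1,\Phi_2$ be dimension functions. (1) If $\Phi(x)\to\infty$ as $x\to0$, then $\overline{\dim}_\Phi\mu=\overline{\dim}_M\mu$. If, in addition, $\overline{\dim}_M\mu<\infty$, then $\underline{\dim}_\Phi\mu=\dim_F\mu$. (2) If $\Phi_1(x),\Phi_2(x)\to\infty$ as $x\to0$, then $\overline{\dim}_{\Phi_1}\mu=\overline{\dim}_{\Phi_2}\mu$. If $\overline{\dim}_M\mu<\infty$, then also $\underline{\dim}_{\Phi_1}\mu=\underline{\dim}_{\Phi_2}\mu$.
   Context: A dimension function is a map $\Phi:(0,1)\to[0,\infty)$ such that $x^{1+\Phi(x)}$ decreases to $0$ as $x$ decreases to $0$. $B(x,R)$ is the open ball of centre $x$ and radius $R$. $\overline{\dim}_\Phi\mu$ is the infimum of all $\alpha$ for which there exist $C_1,C_2>0$ such that for all $0<r<R^{1+\Phi(R)}\le R\le C_1$ and all $x\in\mathrm{supp}\,\mu$, $\mu(B(x,R))/\mu(B(x,r))\le C_2(R/r)^\alpha$; $\underline{\dim}_\Phi\mu$ is the supremum of all $\alpha$ for which there exist $C_1,C_2>0$ such that for the same $r,R,x$, $\mu(B(x,R))/\mu(B(x,r))\ge C_2(R/r)^\alpha$. Values in $[0,\infty]$ are allowed. For a compactly supported measure $\mu$ (with $\mathrm{diam}(\mathrm{supp}\,\mu)>0$), $$\overline{\dim}_M\mu=\inf\{t:\exists B>0 \text{ such that } \inf_{z\in\mathrm{supp}\,\mu}\mu(B(z,r))\ge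 Br^t\ \ \forall\, 0<r\le\mathrm{diam}(\mathrm{supp}\,\mu)\},$$ $$\dim_F\mu=\sup\{s:\exists A>0 \text{ such that } \sup_{z\in\mathrm{supp}\,\mu}\mu(B(z,r))\le Ar^s\ \ \forall\, 0<r\le\mathrm{diam}(\mathrm{supp}\,\mu)\}.$$ *)

theory Defs
  imports "HOL-Probability.Probability"
begin

definition dimension_function :: "(real \<Rightarrow> real) \<Rightarrow> bool" where
  "dimension_function \<Phi> \<longleftrightarrow>
     (\<forall>x\<in>{0<..<1}. 0 \<le> \<Phi> x) \<and>
     mono_on {0<..<1} (\<lambda>x. x powr (1 + \<Phi> x)) \<and>
     ((\<lambda>x. x powr (1 + \<Phi> x)) \<longlongrightarrow> 0) (at_right 0)"

definition msupport :: "'a::metric_space measure \<Rightarrow> 'a set" where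
  "msupport M = {x. \<forall>r>0. measure M (ball x r) > 0}"

text \<open>
  The dimensions below take values in the extended reals; the infimum of the empty set is
  \<open>\<infinity>\<close>.  The exponents range over all reals: for a probability measure whose support is compact
  with positive diameter, negative exponents never qualify in the infima and the exponent 0
  always qualifies in the suprema, so the values lie in \<open>[0, \<infinity>]\<close>.
  Since \<open>\<Phi>\<close> is a total function in HOL, its domain is enforced by \<open>R \<in> {0<..<1}\<close>.
\<close>

definition upper_Phi_dim :: "(real \<Rightarrow> real) \<Rightarrow> 'a::metric_space measure \<Rightarrow> ereal" where
  "upper_Phi_dim \<Phi> M = Inf {ereal \<alpha> | \<alpha>. \<exists>C1>0. \<exists>C2>0. \<forall>R\<in>{0<..<1}. \<forall>r. \<forall>x\<in>msupport M.
     0 < r \<and> r < R powr (1 + \<Phi> R) \<and> R powr (1 + \<Phi> R) \<le> R \<and> R \<le> C1 \<longrightarrow>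
     measure M (ball x R) / measure M (ball x r) \<le> C2 * (R / r) powr \<alpha>}"

definition lower_Phi_dim :: "(real \<Rightarrow> real) \<Rightarrow> 'a::metric_space measure \<Rightarrow> ereal" where
  "lower_Phi_dim \<Phi> M = Sup {ereal \<alpha> | \<alpha>. \<exists>C1>0. \<exists>C2>0. \<forall>R\<in>{0<..<1}. \<forall>r. \<forall>x\<in>msupport M.
     0 < r \<and> r < R powr (1 + \<Phi> R) \<and> R powr (1 + \<Phi> R) \<le> R \<and> R \<le> C1 \<longrightarrow>
     measure M (ball x R) / measure M (ball x r) \<ge> C2 * (R / r) powr \<alpha>}"

definition upper_Minkowski_dim :: "'a::metric_space measure \<Rightarrow> ereal" where
  "upper_Minkowski_dim M = Inf {ereal t | t. \<exists>B>0. \<forall>r. 0 < r \<and> r \<le> diameter (msupport M) \<longrightarrow>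
     (INF z\<in>msupport M. measure M (ball z r)) \<ge> B * r powr t}"

definition Frostman_dim :: "'a::metric_space measure \<Rightarrow> ereal" where
  "Frostman_dim M = Sup {ereal s | s. \<exists>A>0. \<forall>r. 0 < r \<and> r \<le> diameter (msupport M) \<longrightarrow>
     (SUP z\<in>msupport M. measure M (ball z r)) \<le> A * r powr s}"

end

theory Submission
  imports Defs
begin

text \<open>
  Write \<open>m x r\<close> for the mass of the open ball \<open>ball x r\<close>.  When \<open>\<Phi>\<close> is unbounded near \<open>0\<close>, the
  constraint \<open>r < R powr (1 + \<Phi> R)\<close> makes \<open>r\<close> smaller than every fixed power of \<open>R\<close>: for every
  \<open>\<delta> > 0\<close> and every \<open>a\<close>, \<open>r powr \<delta> \<le> R powr a\<close> once \<open>R\<close> is small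
  (\<open>small_scale_powr_le\<close>).  Hence, at the price of an arbitrarily small change of exponent, the
  factor \<open>R\<close> in \<open>(R / r) powr \<alpha>\<close> and the mass \<open>m x R\<close> (as long as it is at least a power of
  \<open>R\<close>) can be ignored, and a bound on the ratio \<open>m x R / m x r\<close> is the same as a bound on
  \<open>m x r\<close> alone.  For the upper dimension \<open>m x R \<le> 1\<close> is all that is used about the large ball.
  For the lower one its mass must be bounded below by a power of \<open>R\<close>, which is why the upper
  Minkowski dimension has to be finite there.

  Conversely, a bound on the ratio yields the bound on \<open>m x r\<close> for small \<open>r\<close> by freezing one
  admissible \<open>R\<close>.  In the upper case this needs \<open>m x R\<close> to be bounded below uniformly in \<open>x\<close>,
  which is where compactness of the support enters (\<open>uniform_mass_lower_bound\<close>).  The remaining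
  radii, bounded away from \<open>0\<close>, affect only the constants.

  Part (2) follows from part (1), because the upper Minkowski and Frostman dimensions do not
  involve \<open>\<Phi>\<close>.
\<close>

section \<open>Powers of two separated scales\<close>

text \<open>
  Since \<open>r powr \<delta> < R powr ((1 + \<Phi> R) * \<delta>)\<close> and \<open>R < 1\<close>, it suffices that \<open>(1 + \<Phi> R) * \<delta> \<ge> a\<close>.
\<close>

lemma small_scale_powr_le:
  fixes \<Phi> :: "real \<Rightarrow> real"
  assumes "filterlim \<Phi> at_top (at_right 0)" and "\<delta> > 0"
  obtains C where "C > 0"
    and "\<And>R r. \<lbrakk>0 < R; R < 1; R \<le> C; 0 < r; r < R powr (1 + \<Phi> R)\<rbrakk> \<Longrightarrow> r powr \<delta> \<le> R powr a"
proof -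
  have "eventually (\<lambda>R. a / \<delta> \<le> \<Phi> R) (at_right 0)"
    using assms(1) by (auto simp: filterlim_at_top)
  then obtain b where b: "b > 0" "\<And>R. 0 < R \<Longrightarrow> R < b \<Longrightarrow> a / \<delta> \<le> \<Phi> R"
    by (auto simp: eventually_at_right[of 0 1])
  show thesis
  proof
    show "b / 2 > 0" using b by simp
    fix R r :: real
    assume R: "0 < R" "R < 1" "R \<le> b / 2" and r: "0 < r" "r < R powr (1 + \<Phi> R)"
    have "a / \<delta> \<le> \<Phi> R" using b R by simp
    then have "a \<le> \<Phi> R * \<delta>" using \<open>\<delta> > 0\<close> by (simp add: field_simps)
    then have exponent: "a \<le> (1 + \<Phi> R) * \<delta>" using \<open>\<delta> > 0\<close> by (simp add: algebra_simps)
    have "r powr \<delta> \<le> (R powr (1 + \<Phi> R)) powr \<delta>"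
      using r \<open>\<delta> > 0\<close> by (intro powr_mono2) auto
    also have "\<dots> = R powr ((1 + \<Phi> R) * \<delta>)" by (simp add: powr_powr)
    also have "\<dots> \<le> R powr a" using exponent R by (intro powr_mono') auto
    finally show "r powr \<delta> \<le> R powr a" .
  qed
qed

lemma powr_le_max_endpoints:
  fixes r t :: real
  assumes "0 < \<rho>" "\<rho> \<le> r" "r \<le> D"
  shows "r powr t \<le> max (\<rho> powr t) (D powr t)"
proof (cases "t \<ge> 0")
  case True
  then have "r powr t \<le> D powr t" using assms by (intro powr_mono2) auto
  then show ?thesis by simp
next
  case False
  then have "r powr t \<le> \<rho> powr t" using assms by (intro powr_mono2') auto
  then show ?thesis by simp
qed

section \<open>Masses of balls centred in a compact support\<close>

lemma ball_mass_pos: "x \<in> msupport M \<Longrightarrow> 0 < r \<Longrightarrow> 0 < measure M (ball x r)"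
  by (simp add: msupport_def)

locale compactly_supported_prob = prob_space M for M :: "'a::metric_space measure" +
  assumes sets_eq_borel: "sets M = sets borel"
    and compact_msupport: "compact (msupport M)"
    and diameter_msupport_pos: "0 < diameter (msupport M)"
begin

lemma msupport_nonempty: "msupport M \<noteq> {}"
  using diameter_msupport_pos by auto

lemma ball_mass_mono:
  assumes "ball x r \<subseteq> ball y R" shows "measure M (ball x r) \<le> measure M (ball y R)"
  using assms by (intro finite_measure_mono) (simp_all add: sets_eq_borel)

text \<open>
  Cover the support by finitely many balls of radius \<open>r / 2\<close>; a ball of radius \<open>r\<close> contains the
  member of the cover in which its centre lies.
\<close>

lemma uniform_mass_lower_bound:
  assumes "r > 0"
  obtains b where "b > 0" and "\<And>x. x \<in> msupport M \<Longrightarrow> b \<le> measure M (ball x r)"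
proof -
  obtain F where F: "finite F" "F \<subseteq> msupport M" "msupport M \<subseteq> (\<Union>c\<in>F. ball c (r / 2))"
    using compactE_image[OF compact_msupport, of "msupport M" "\<lambda>c. ball c (r / 2)"] \<open>r > 0\<close>
    by (metis UN_I centre_in_ball half_gt_zero open_ball subsetI)
  have "F \<noteq> {}" using F msupport_nonempty by auto
  define b where "b = Min ((\<lambda>c. measure M (ball c (r / 2))) ` F)"
  show thesis
  proof
    show "b > 0"
      using F \<open>F \<noteq> {}\<close> \<open>r > 0\<close> unfolding b_def by (auto intro!: ball_mass_pos)
    fix x assume "x \<in> msupport M"
    then obtain c where c: "c \<in> F" "dist c x < r / 2" using F by fastforce
    have "ball c (r / 2) \<subseteq> ball x r"
    proof
      fix y assume "y \<in> ball c (r / 2)"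
      then show "y \<in> ball x r" using c dist_triangle[of x y c] by (simp add: dist_commute)
    qed
    then have "measure M (ball c (r / 2)) \<le> measure M (ball x r)" by (rule ball_mass_mono)
    moreover have "b \<le> measure M (ball c (r / 2))" using F c by (simp add: b_def)
    ultimately show "b \<le> measure M (ball x r)" by simp
  qed
qed

section \<open>Exponents of single balls and of pairs of balls\<close>

text \<open>
  Stating the bounds pointwise, rather than for the extremum over the support, keeps conditionally
  complete infima and suprema out of the estimates.
\<close>

definition Minkowski_exponent :: "real \<Rightarrow> bool" where
  "Minkowski_exponent t \<longleftrightarrow> (\<exists>B>0. \<forall>r x. 0 < r \<and> r \<le> diameter (msupport M) \<and> x \<in> msupport M
     \<longrightarrow> B * r powr t \<le> measure M (ball x r))"

definition Frostman_exponent :: "real \<Rightarrow> bool" where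
  "Frostman_exponent s \<longleftrightarrow> (\<exists>A>0. \<forall>r x. 0 < r \<and> r \<le> diameter (msupport M) \<and> x \<in> msupport M
     \<longrightarrow> measure M (ball x r) \<le> A * r powr s)"

definition upper_Phi_exponent :: "(real \<Rightarrow> real) \<Rightarrow> real \<Rightarrow> bool" where
  "upper_Phi_exponent \<Phi> \<alpha> \<longleftrightarrow> (\<exists>C1>0. \<exists>C2>0. \<forall>R\<in>{0<..<1}. \<forall>r. \<forall>x\<in>msupport M.
     0 < r \<and> r < R powr (1 + \<Phi> R) \<and> R powr (1 + \<Phi> R) \<le> R \<and> R \<le> C1 \<longrightarrow>
     measure M (ball x R) / measure M (ball x r) \<le> C2 * (R / r) powr \<alpha>)"

definition lower_Phi_exponent :: "(real \<Rightarrow> real) \<Rightarrow> real \<Rightarrow> bool" where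
  "lower_Phi_exponent \<Phi> \<alpha> \<longleftrightarrow> (\<exists>C1>0. \<exists>C2>0. \<forall>R\<in>{0<..<1}. \<forall>r. \<forall>x\<in>msupport M.
     0 < r \<and> r < R powr (1 + \<Phi> R) \<and> R powr (1 + \<Phi> R) \<le> R \<and> R \<le> C1 \<longrightarrow>
     measure M (ball x R) / measure M (ball x r) \<ge> C2 * (R / r) powr \<alpha>)"

lemma upper_Phi_dim_eq: "upper_Phi_dim \<Phi> M = (INF \<alpha>\<in>Collect (upper_Phi_exponent \<Phi>). ereal \<alpha>)"
  unfolding upper_Phi_dim_def upper_Phi_exponent_def by (simp add: image_Collect)

lemma lower_Phi_dim_eq: "lower_Phi_dim \<Phi> M = (SUP \<alpha>\<in>Collect (lower_Phi_exponent \<Phi>). ereal \<alpha>)"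
  unfolding lower_Phi_dim_def lower_Phi_exponent_def by (simp add: image_Collect)

lemma upper_Minkowski_dim_eq: "upper_Minkowski_dim M = (INF t\<in>Collect Minkowski_exponent. ereal t)"
proof -
  have "c \<le> (INF z\<in>msupport M. measure M (ball z r)) \<longleftrightarrow>
      (\<forall>z\<in>msupport M. c \<le> measure M (ball z r))" for c r
    by (rule le_cINF_iff[OF msupport_nonempty]) (auto intro!: bdd_belowI[of _ 0])
  then have "Minkowski_exponent t \<longleftrightarrow> (\<exists>B>0. \<forall>r. 0 < r \<and> r \<le> diameter (msupport M) \<longrightarrow>
      (INF z\<in>msupport M. measure M (ball z r)) \<ge> B * r powr t)" for t
    unfolding Minkowski_exponent_def by blast
  then show ?thesis unfolding upper_Minkowski_dim_def by (simp add: image_Collect)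
qed

lemma Frostman_dim_eq: "Frostman_dim M = (SUP s\<in>Collect Frostman_exponent. ereal s)"
proof -
  have "(SUP z\<in>msupport M. measure M (ball z r)) \<le> c \<longleftrightarrow>
      (\<forall>z\<in>msupport M. measure M (ball z r) \<le> c)" for c r
    by (rule cSUP_le_iff[OF msupport_nonempty]) (auto intro!: bdd_aboveI[of _ 1])
  then have "Frostman_exponent s \<longleftrightarrow> (\<exists>A>0. \<forall>r. 0 < r \<and> r \<le> diameter (msupport M) \<longrightarrow>
      (SUP z\<in>msupport M. measure M (ball z r)) \<le> A * r powr s)" for s
    unfolding Frostman_exponent_def by blast
  then show ?thesis unfolding Frostman_dim_def by (simp add: image_Collect)
qed

section \<open>From single balls to pairs of balls\<close>

text \<open>
  Here \<open>m x R / m x r \<le> 1 / m x r \<le> r powr (- t) / B\<close>, and the gap \<open>\<alpha> - t\<close> pays for the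
  missing factor: \<open>r powr (\<alpha> - t) \<le> R powr \<alpha>\<close> for admissible small scales.
\<close>

lemma upper_Phi_exponent_if_Minkowski:
  assumes lim: "filterlim \<Phi> at_top (at_right 0)" and t: "Minkowski_exponent t" and "t < \<alpha>"
  shows "upper_Phi_exponent \<Phi> \<alpha>"
proof -
  obtain B where B: "B > 0" "\<And>r x. \<lbrakk>0 < r; r \<le> diameter (msupport M); x \<in> msupport M\<rbrakk>
      \<Longrightarrow> B * r powr t \<le> measure M (ball x r)"
    using t unfolding Minkowski_exponent_def by blast
  obtain C where C: "C > 0" "\<And>R r. \<lbrakk>0 < R; R < 1; R \<le> C; 0 < r; r < R powr (1 + \<Phi> R)\<rbrakk>
      \<Longrightarrow> r powr (\<alpha> - t) \<le> R powr \<alpha>"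
    using small_scale_powr_le[OF lim, of "\<alpha> - t" \<alpha>] \<open>t < \<alpha>\<close> by auto
  show ?thesis
    unfolding upper_Phi_exponent_def
  proof (rule exI[of _ "min C (diameter (msupport M))"],
      intro exI[of _ "1 / B"] conjI ballI allI impI)
    show "min C (diameter (msupport M)) > 0" using C diameter_msupport_pos by simp
    show "1 / B > 0" using B by simp
    fix R r x
    assume R: "R \<in> {0<..<1}" and x: "x \<in> msupport M"
      and rR: "0 < r \<and> r < R powr (1 + \<Phi> R) \<and> R powr (1 + \<Phi> R) \<le> R
        \<and> R \<le> min C (diameter (msupport M))"
    have mass: "B * r powr t \<le> measure M (ball x r)" using B(2) rR x by simp
    have "measure M (ball x R) / measure M (ball x r) \<le> 1 / (B * r powr t)"
      using mass B(1) rR by (intro frac_le) auto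
    also have "\<dots> = 1 / B * (r powr (\<alpha> - t) / r powr \<alpha>)"
      using rR B(1) by (simp add: powr_diff)
    also have "\<dots> \<le> 1 / B * (R powr \<alpha> / r powr \<alpha>)"
      using C(2)[of R r] rR R B(1) by (intro mult_left_mono divide_right_mono) auto
    also have "R powr \<alpha> / r powr \<alpha> = (R / r) powr \<alpha>"
      using rR R by (simp add: powr_divide)
    finally show "measure M (ball x R) / measure M (ball x r) \<le> 1 / B * (R / r) powr \<alpha>" .
  qed
qed

text \<open>
  Here \<open>m x R / m x r \<ge> B * R powr t / (A * r powr s)\<close>, where \<open>t\<close> is any Minkowski exponent,
  however large: the gap \<open>s - \<alpha>\<close> absorbs the unwanted power through
  \<open>r powr (s - \<alpha>) \<le> R powr (t - \<alpha>)\<close>.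
\<close>

lemma lower_Phi_exponent_if_Frostman:
  assumes lim: "filterlim \<Phi> at_top (at_right 0)"
    and t: "Minkowski_exponent t" and s: "Frostman_exponent s" and "\<alpha> < s"
  shows "lower_Phi_exponent \<Phi> \<alpha>"
proof -
  obtain B where B: "B > 0" "\<And>r x. \<lbrakk>0 < r; r \<le> diameter (msupport M); x \<in> msupport M\<rbrakk>
      \<Longrightarrow> B * r powr t \<le> measure M (ball x r)"
    using t unfolding Minkowski_exponent_def by blast
  obtain A where A: "A > 0" "\<And>r x. \<lbrakk>0 < r; r \<le> diameter (msupport M); x \<in> msupport M\<rbrakk>
      \<Longrightarrow> measure M (ball x r) \<le> A * r powr s"
    using s unfolding Frostman_exponent_def by blast
  obtain C where C: "C > 0" "\<And>R r. \<lbrakk>0 < R; R < 1; R \<le> C; 0 < r; r < R powr (1 + \<Phi> R)\<rbrakk>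
      \<Longrightarrow> r powr (s - \<alpha>) \<le> R powr (t - \<alpha>)"
    using small_scale_powr_le[OF lim, of "s - \<alpha>" "t - \<alpha>"] \<open>\<alpha> < s\<close> by auto
  show ?thesis
    unfolding lower_Phi_exponent_def
  proof (rule exI[of _ "min C (diameter (msupport M))"],
      intro exI[of _ "B / A"] conjI ballI allI impI)
    show "min C (diameter (msupport M)) > 0" using C diameter_msupport_pos by simp
    show "B / A > 0" using A B by simp
    fix R r x
    assume R: "R \<in> {0<..<1}" and x: "x \<in> msupport M"
      and rR: "0 < r \<and> r < R powr (1 + \<Phi> R) \<and> R powr (1 + \<Phi> R) \<le> R
        \<and> R \<le> min C (diameter (msupport M))"
    have "r powr s * R powr \<alpha> = r powr (s - \<alpha>) * (r powr \<alpha> * R powr \<alpha>)"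
      using rR by (simp add: powr_diff)
    also have "\<dots> \<le> R powr (t - \<alpha>) * (r powr \<alpha> * R powr \<alpha>)"
      using C(2)[of R r] rR R by (intro mult_right_mono) auto
    also have "\<dots> = R powr t * r powr \<alpha>"
      using R by (simp add: powr_diff)
    finally have scales: "R powr \<alpha> / r powr \<alpha> \<le> R powr t / r powr s"
      using rR by (simp add: field_simps)
    have "B / A * (R / r) powr \<alpha> = B / A * (R powr \<alpha> / r powr \<alpha>)"
      using rR R by (simp add: powr_divide)
    also have "\<dots> \<le> B / A * (R powr t / r powr s)"
      using scales A B by (intro mult_left_mono) auto
    also have "\<dots> = (B * R powr t) / (A * r powr s)" by simp
    also have "\<dots> \<le> measure M (ball x R) / measure M (ball x r)"
      using A(2)[of r x] B(2)[of R x] B(1) rR R x ball_mass_pos[of x M r]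
      by (intro frac_le) auto
    finally show "B / A * (R / r) powr \<alpha> \<le> measure M (ball x R) / measure M (ball x r)" .
  qed
qed

section \<open>From pairs of balls to single balls\<close>

text \<open>
  One admissible large radius \<open>R\<close> serves all \<open>r < \<rho>\<close>, where \<open>\<rho> = R powr (1 + \<Phi> R)\<close>.
\<close>

lemma admissible_scale:
  assumes "\<forall>x\<in>{0<..<1}. 0 \<le> \<Phi> x" and "C1 > (0::real)"
  obtains R where "R \<in> {0<..<1}" and "R \<le> C1" and "R powr (1 + \<Phi> R) \<le> R"
proof -
  define R where "R = min C1 (1 / 2)"
  have R: "R \<in> {0<..<1}" "R \<le> C1" using assms by (auto simp: R_def)
  have "R powr (1 + \<Phi> R) \<le> R powr 1" using R assms by (intro powr_mono') auto
  then have "R powr (1 + \<Phi> R) \<le> R" using R by simp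
  with R show thesis by (rule that)
qed

text \<open>
  Radii \<open>r \<ge> \<rho>\<close> are settled by the uniform lower bound at scale \<open>\<rho>\<close>, smaller ones by comparison
  with the ball of the fixed radius \<open>R\<close>.
\<close>

lemma Minkowski_exponent_if_upper_Phi:
  assumes nonneg: "\<forall>x\<in>{0<..<1}. 0 \<le> \<Phi> x" and \<alpha>: "upper_Phi_exponent \<Phi> \<alpha>"
  shows "Minkowski_exponent \<alpha>"
proof -
  let ?D = "diameter (msupport M)"
  obtain C1 C2 where C: "C1 > 0" "C2 > 0" "\<And>R r x. \<lbrakk>R \<in> {0<..<1}; x \<in> msupport M; 0 < r;
      r < R powr (1 + \<Phi> R); R powr (1 + \<Phi> R) \<le> R; R \<le> C1\<rbrakk>
      \<Longrightarrow> measure M (ball x R) / measure M (ball x r) \<le> C2 * (R / r) powr \<alpha>"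
    using \<alpha> unfolding upper_Phi_exponent_def by blast
  obtain R where R: "R \<in> {0<..<1}" "R \<le> C1" "R powr (1 + \<Phi> R) \<le> R"
    using admissible_scale[OF nonneg C(1)] .
  define \<rho> where "\<rho> = R powr (1 + \<Phi> R)"
  have "\<rho> > 0" using R by (simp add: \<rho>_def)
  obtain b where b: "b > 0" "\<And>x. x \<in> msupport M \<Longrightarrow> b \<le> measure M (ball x \<rho>)"
    using uniform_mass_lower_bound[OF \<open>\<rho> > 0\<close>] by blast
  define K where "K = max (\<rho> powr \<alpha>) (?D powr \<alpha>)"
  have "K > 0" using \<open>\<rho> > 0\<close> by (simp add: K_def less_max_iff_disj)
  define B where "B = min (b / K) (b / (C2 * R powr \<alpha>))"
  show ?thesis
    unfolding Minkowski_exponent_def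
  proof (intro exI[of _ B] conjI allI impI)
    show "B > 0" using b C R \<open>K > 0\<close> by (simp add: B_def)
    fix r x assume "0 < r \<and> r \<le> ?D \<and> x \<in> msupport M"
    then have r: "0 < r" "r \<le> ?D" and x: "x \<in> msupport M" by auto
    show "B * r powr \<alpha> \<le> measure M (ball x r)"
    proof (cases "\<rho> \<le> r")
      case True
      have "B * r powr \<alpha> \<le> b / K * K"
        using powr_le_max_endpoints[OF \<open>\<rho> > 0\<close> True r(2), of \<alpha>] b \<open>K > 0\<close>
        by (intro mult_mono) (auto simp: B_def K_def)
      also have "\<dots> = b" using \<open>K > 0\<close> by simp
      also have "\<dots> \<le> measure M (ball x \<rho>)" using b x by blast
      also have "\<dots> \<le> measure M (ball x r)" using True by (intro ball_mass_mono subset_ball)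
      finally show ?thesis .
    next
      case False
      have pos: "0 < measure M (ball x r)" using x r(1) by (rule ball_mass_pos)
      have "b \<le> measure M (ball x R)"
        using b(2)[OF x] ball_mass_mono[OF subset_ball[OF R(3), of x]] by (simp add: \<rho>_def)
      also have "\<dots> \<le> C2 * (R / r) powr \<alpha> * measure M (ball x r)"
        using C(3)[OF R(1) x r(1) _ R(3,2)] False pos by (simp add: \<rho>_def pos_divide_le_eq)
      finally have "b / (C2 * R powr \<alpha>) * r powr \<alpha> \<le> measure M (ball x r)"
        using C R r by (simp add: powr_divide field_simps)
      moreover have "B * r powr \<alpha> \<le> b / (C2 * R powr \<alpha>) * r powr \<alpha>"
        by (intro mult_right_mono) (auto simp: B_def)
      ultimately show ?thesis by simp
    qed
  qed
qed

lemma Frostman_exponent_if_lower_Phi: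
  assumes nonneg: "\<forall>x\<in>{0<..<1}. 0 \<le> \<Phi> x" and \<alpha>: "lower_Phi_exponent \<Phi> \<alpha>"
  shows "Frostman_exponent \<alpha>"
proof -
  let ?D = "diameter (msupport M)"
  obtain C1 C2 where C: "C1 > 0" "C2 > 0" "\<And>R r x. \<lbrakk>R \<in> {0<..<1}; x \<in> msupport M; 0 < r;
      r < R powr (1 + \<Phi> R); R powr (1 + \<Phi> R) \<le> R; R \<le> C1\<rbrakk>
      \<Longrightarrow> measure M (ball x R) / measure M (ball x r) \<ge> C2 * (R / r) powr \<alpha>"
    using \<alpha> unfolding lower_Phi_exponent_def by blast
  obtain R where R: "R \<in> {0<..<1}" "R \<le> C1" "R powr (1 + \<Phi> R) \<le> R"
    using admissible_scale[OF nonneg C(1)] .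
  define \<rho> where "\<rho> = R powr (1 + \<Phi> R)"
  have "\<rho> > 0" using R by (simp add: \<rho>_def)
  \<comment> \<open>The exponent is negated so that an upper bound for \<open>r powr (- \<alpha>)\<close> bounds \<open>r powr \<alpha>\<close> from
    below on \<open>{\<rho>..?D}\<close>; there the trivial bound \<open>m x r \<le> 1\<close> is enough.\<close>
  define K where "K = max (\<rho> powr (- \<alpha>)) (?D powr (- \<alpha>))"
  have "K > 0" using \<open>\<rho> > 0\<close> by (simp add: K_def less_max_iff_disj)
  define A where "A = max K (1 / (C2 * R powr \<alpha>))"
  show ?thesis
    unfolding Frostman_exponent_def
  proof (intro exI[of _ A] conjI allI impI)
    show "A > 0" using \<open>K > 0\<close> by (simp add: A_def less_max_iff_disj)
    fix r x assume "0 < r \<and> r \<le> ?D \<and> x \<in> msupport M"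
    then have r: "0 < r" "r \<le> ?D" and x: "x \<in> msupport M" by auto
    show "measure M (ball x r) \<le> A * r powr \<alpha>"
    proof (cases "\<rho> \<le> r")
      case True
      have "measure M (ball x r) \<le> r powr (- \<alpha>) * r powr \<alpha>"
        using r by (simp flip: powr_add)
      also have "\<dots> \<le> A * r powr \<alpha>"
        using powr_le_max_endpoints[OF \<open>\<rho> > 0\<close> True r(2), of "- \<alpha>"]
        by (intro mult_right_mono) (auto simp: A_def K_def)
      finally show ?thesis .
    next
      case False
      have pos: "0 < measure M (ball x r)" using x r(1) by (rule ball_mass_pos)
      have "C2 * (R / r) powr \<alpha> * measure M (ball x r) \<le> measure M (ball x R)"
        using C(3)[OF R(1) x r(1) _ R(3,2)] False pos by (simp add: \<rho>_def pos_le_divide_eq)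
      also have "\<dots> \<le> 1" by simp
      finally have "measure M (ball x r) \<le> 1 / (C2 * R powr \<alpha>) * r powr \<alpha>"
        using C R r by (simp add: powr_divide field_simps)
      also have "\<dots> \<le> A * r powr \<alpha>"
        by (intro mult_right_mono) (auto simp: A_def)
      finally show ?thesis .
    qed
  qed
qed

section \<open>Equality of the dimensions\<close>

theorem upper_Phi_dim_eq_upper_Minkowski_dim:
  assumes "dimension_function \<Phi>" and lim: "filterlim \<Phi> at_top (at_right 0)"
  shows "upper_Phi_dim \<Phi> M = upper_Minkowski_dim M"
proof (rule antisym)
  have nonneg: "\<forall>x\<in>{0<..<1}. 0 \<le> \<Phi> x" using assms(1) by (simp add: dimension_function_def)
  show "upper_Minkowski_dim M \<le> upper_Phi_dim \<Phi> M"
    unfolding upper_Phi_dim_eq upper_Minkowski_dim_eq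
    using Minkowski_exponent_if_upper_Phi[OF nonneg] by (intro INF_superset_mono) auto
  show "upper_Phi_dim \<Phi> M \<le> upper_Minkowski_dim M"
    unfolding upper_Minkowski_dim_eq
  proof (rule INF_greatest)
    fix t assume t: "t \<in> Collect Minkowski_exponent"
    have "upper_Phi_dim \<Phi> M \<le> ereal t + ereal e" if "e > 0" for e
    proof -
      have "upper_Phi_exponent \<Phi> (t + e)"
        using t that by (intro upper_Phi_exponent_if_Minkowski[OF lim]) auto
      then have "upper_Phi_dim \<Phi> M \<le> ereal (t + e)"
        unfolding upper_Phi_dim_eq by (intro INF_lower) simp
      then show ?thesis by simp
    qed
    then show "upper_Phi_dim \<Phi> M \<le> ereal t" by (rule ereal_le_epsilon2)
  qed
qed

theorem lower_Phi_dim_eq_Frostman_dim: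
  assumes "dimension_function \<Phi>" and lim: "filterlim \<Phi> at_top (at_right 0)"
    and "upper_Minkowski_dim M < \<infinity>"
  shows "lower_Phi_dim \<Phi> M = Frostman_dim M"
proof (rule antisym)
  have nonneg: "\<forall>x\<in>{0<..<1}. 0 \<le> \<Phi> x" using assms(1) by (simp add: dimension_function_def)
  show "lower_Phi_dim \<Phi> M \<le> Frostman_dim M"
    unfolding lower_Phi_dim_eq Frostman_dim_eq
    using Frostman_exponent_if_lower_Phi[OF nonneg] by (intro SUP_subset_mono) auto
  obtain t where t: "Minkowski_exponent t"
    using assms(3) unfolding upper_Minkowski_dim_eq INF_less_iff by blast
  show "Frostman_dim M \<le> lower_Phi_dim \<Phi> M"
    unfolding Frostman_dim_eq
  proof (rule SUP_least)
    fix s assume s: "s \<in> Collect Frostman_exponent"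
    have "ereal s \<le> lower_Phi_dim \<Phi> M + ereal e" if "e > 0" for e
    proof -
      have "lower_Phi_exponent \<Phi> (s - e)"
        using s that by (intro lower_Phi_exponent_if_Frostman[OF lim t]) auto
      then have "ereal (s - e) \<le> lower_Phi_dim \<Phi> M"
        unfolding lower_Phi_dim_eq by (intro SUP_upper) simp
      then show ?thesis by (cases "lower_Phi_dim \<Phi> M") auto
    qed
    then show "ereal s \<le> lower_Phi_dim \<Phi> M" by (rule ereal_le_epsilon2)
  qed
qed

end

theorem corollary2p22:
  fixes M :: "'a::metric_space measure"
    and \<Phi> \<Phi>1 \<Phi>2 :: "real \<Rightarrow> real"
  assumes "prob_space M" and "sets M = sets borel"
    and "compact (msupport M)" and "diameter (msupport M) > 0"
    and "dimension_function \<Phi>" and "dimension_function \<Phi>1" and "dimension_function \<Phi>2"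
  shows "(filterlim \<Phi> at_top (at_right 0) \<longrightarrow>
            upper_Phi_dim \<Phi> M = upper_Minkowski_dim M \<and>
            (upper_Minkowski_dim M < \<infinity> \<longrightarrow> lower_Phi_dim \<Phi> M = Frostman_dim M)) \<and>
         (filterlim \<Phi>1 at_top (at_right 0) \<and> filterlim \<Phi>2 at_top (at_right 0) \<longrightarrow>
            upper_Phi_dim \<Phi>1 M = upper_Phi_dim \<Phi>2 M \<and>
            (upper_Minkowski_dim M < \<infinity> \<longrightarrow> lower_Phi_dim \<Phi>1 M = lower_Phi_dim \<Phi>2 M))"
proof -
  interpret compactly_supported_prob M
    using assms by (intro compactly_supported_prob.intro compactly_supported_prob_axioms.intro)
  show ?thesis
    using assms(5-7)
    by (simp add: upper_Phi_dim_eq_upper_Minkowski_dim lower_Phi_dim_eq_Frostman_dim)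
qed

end
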